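(* If $\mathbf P=(P,\leq,{}')$ is a finite poset with an antitone involution, then the Dedekind-MacNeille completion $\mathbf{DM}(\mathbf P)=(\mathrm{DM}(\mathbf P),\subseteq,{}^* )$ is a Kleene algebra if and only if $\mathbf P$ is a Kleene poset.
   Context: Let $(P,\leq)$ be a poset. For $A,B\subseteq P$ write $A\leq B$ if $x\leq y$ for all $x\in A$, $y\in B$. Put $L(A)=\{x\in P\mid x\leq y\text{ for all }y\in A\}$ and $U(A)=\{x\in P\mid y\leq x\text{ for all }y\in A\}$. Write $L(a,b)=L(\{a,b\})$, $L(A,b)=L(A\cup\{b\})$, $L(A,B)=L(A\cup B)$, $LU(A)=L(U(A))$, and analogously for $U$. A unary operation $'$ on $P$ is antitone if $x\leq y$ implies $y'\leq x'$, and an involution if $x''=x$ for all $x$. For $A\subseteq P$ put $A'=\{x'\mid x\in A\}$. A poset is distributive if $L(U(x,y),z)=LU(L(x,z),L(y,z))$ for all elements $x,y,z$. A pseudo-Kleene poset is a poset $(P,\leq,{}')$ with an antitone involution satisfying $L(x,x')\leq U(y,y')$ for all $x,y\in P$. A Kleene poset is a distributive pseudo-Kleene poset. A pseudo-Kleene algebra is a lattice $(L,\vee,\wedge,{}')$ with an antitone involution satisfying $x\wedge x'\leq y\vee y'$ for all $x,y\in L$. A Kleene algebra is a distributive pseudo-Kleene algebra. For a poset $\mathbf P=(P,\leq,{}')$ with an antitone involution put $\mathrm{DM}(\mathbf P)=\{L(A)\mid A\subseteq P\}$ and $A^*=L(A')$ for $A\in\mathrm{DM}(\mathbf P)$. The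 structure $\mathbf{DM}(\mathbf P)=(\mathrm{DM}(\mathbf P),\subseteq,{}^* )$ is a complete lattice with an antitone involution (with $A\wedge B=A\cap B$ and $A\vee B=LU(A,B)$), called the Dedekind-MacNeille completion of $\mathbf P$. *)

theory Defs
  imports "HOL-Algebra.Lattice"
begin

text \<open>
  The operators \<open>L\<close> and \<open>U\<close> of the order-theoretic literature are \<^const>\<open>Lower\<close> and
  \<^const>\<open>Upper\<close>.
\<close>

record 'a igorder = "'a gorder" +
  invol :: "'a \<Rightarrow> 'a"

definition set_le :: "('a, 'b) gorder_scheme \<Rightarrow> 'a set \<Rightarrow> 'a set \<Rightarrow> bool"
  where "set_le P A B \<longleftrightarrow> (\<forall>x\<in>A. \<forall>y\<in>B. x \<sqsubseteq>\<^bsub>P\<^esub> y)"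

locale antitone_involution_poset = partial_order P for P (structure) +
  assumes invol_closed: "x \<in> carrier P \<Longrightarrow> invol P x \<in> carrier P"
    and invol_antitone:
      "\<lbrakk>x \<in> carrier P; y \<in> carrier P; x \<sqsubseteq> y\<rbrakk> \<Longrightarrow> invol P y \<sqsubseteq> invol P x"
    and invol_invol: "x \<in> carrier P \<Longrightarrow> invol P (invol P x) = x"

locale distributive_poset = partial_order P for P (structure) +
  assumes Lower_Upper_distrib:
    "\<lbrakk>x \<in> carrier P; y \<in> carrier P; z \<in> carrier P\<rbrakk> \<Longrightarrow>
      Lower P (Upper P {x, y} \<union> {z}) =
      Lower P (Upper P (Lower P {x, z} \<union> Lower P {y, z}))"

locale pseudo_kleene_poset = antitone_involution_poset P for P (structure) +
  assumes Lower_le_Upper: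
    "\<lbrakk>x \<in> carrier P; y \<in> carrier P\<rbrakk> \<Longrightarrow>
      set_le P (Lower P {x, invol P x}) (Upper P {y, invol P y})"

locale kleene_poset = pseudo_kleene_poset P + distributive_poset P for P (structure)

locale distributive_lattice = lattice L for L (structure) +
  assumes meet_join_distrib:
    "\<lbrakk>x \<in> carrier L; y \<in> carrier L; z \<in> carrier L\<rbrakk> \<Longrightarrow>
      x \<sqinter> (y \<squnion> z) = (x \<sqinter> y) \<squnion> (x \<sqinter> z)"

locale pseudo_kleene_algebra = lattice L + antitone_involution_poset L for L (structure) +
  assumes meet_le_join:
    "\<lbrakk>x \<in> carrier L; y \<in> carrier L\<rbrakk> \<Longrightarrow> x \<sqinter> invol L x \<sqsubseteq> y \<squnion> invol L y"

locale kleene_algebra = pseudo_kleene_algebra L + distributive_lattice L for L (structure)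

definition DM :: "('a, 'b) igorder_scheme \<Rightarrow> 'a set igorder"
  where "DM P =
    \<lparr> carrier = {Lower P A | A. A \<subseteq> carrier P},
      eq = (=),
      le = (\<subseteq>),
      invol = (\<lambda>A. Lower P (invol P ` A)) \<rparr>"

end

theory Submission
  imports Defs
begin

text \<open>
  The completion is first made concrete: its members are the sets fixed by the closure operator
  \<open>LU\<close>, its meet is intersection, its join is \<open>LU\<close> of the union, and the involution sends the
  principal ideal of \<open>x\<close> to the principal ideal of \<open>x'\<close>. Evaluated at principal ideals, each of the
  two lattice laws becomes the corresponding law for elements of \<open>P\<close>, which gives one direction
  of the equivalence.

  The Kleene inequality passes to the completion element by element. An element \<open>x\<close> of
  \<open>A \<sqinter> A\<^sup>*\<close> satisfies \<open>x \<sqsubseteq> x'\<close>, an upper bound \<open>u\<close> of \<open>B \<union> B\<^sup>*\<close> satisfies \<open>u' \<sqsubseteq> u\<close>, and the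
  inequality in \<open>P\<close> applied to the pair \<open>x\<close>, \<open>u\<close> gives \<open>x \<sqsubseteq> u\<close>.

  Distributivity is where finiteness enters, since the law for elements only speaks about upper
  bounds of two elements while a join of ideals involves upper bounds of arbitrary sets. The bridge
  is a prime separation property (\<open>finite_prime_separation\<close>): if \<open>p \<sqsubseteq> m\<close> fails, there are \<open>j \<sqsubseteq> p\<close>
  and \<open>n \<sqsupseteq> m\<close> such that \<open>j \<sqsubseteq> n\<close> fails and every element lies above \<open>j\<close> or below \<open>n\<close>. Such a \<open>j\<close>
  behaves like a join-prime element with respect to joins of arbitrary sets: if \<open>j\<close> is in \<open>LU(S)\<close>,
  then some element of \<open>S\<close> lies above \<open>j\<close>, for otherwise \<open>n\<close> would bound \<open>S\<close> and hence \<open>j\<close>.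
\<close>

section \<open>Cones in a partial order\<close>

context partial_order
begin

lemma mem_Lower_iff:
  assumes "A \<subseteq> carrier L"
  shows "z \<in> Lower L A \<longleftrightarrow> z \<in> carrier L \<and> (\<forall>x\<in>A. z \<sqsubseteq> x)"
  using assms unfolding Lower_def by blast

lemma mem_Upper_iff:
  assumes "A \<subseteq> carrier L"
  shows "z \<in> Upper L A \<longleftrightarrow> z \<in> carrier L \<and> (\<forall>x\<in>A. x \<sqsubseteq> z)"
  using assms unfolding Upper_def by blast

lemma subset_Lower_Upper:
  assumes "A \<subseteq> carrier L"
  shows "A \<subseteq> Lower L (Upper L A)"
  using assms by (auto simp: mem_Lower_iff mem_Upper_iff)

lemma Lower_Upper_Lower:
  assumes "A \<subseteq> carrier L"
  shows "Lower L (Upper L (Lower L A)) = Lower L A"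
proof (rule subset_antisym)
  have "A \<subseteq> Upper L (Lower L A)"
    using assms by (auto simp: mem_Lower_iff mem_Upper_iff)
  then show "Lower L (Upper L (Lower L A)) \<subseteq> Lower L A"
    by (rule Lower_antimono)
qed (simp add: subset_Lower_Upper)

lemma Upper_principal:
  assumes "x \<in> carrier L"
  shows "Upper L (Lower L {x}) = Upper L {x}"
proof -
  have "z \<sqsubseteq> u" if "x \<sqsubseteq> u" "z \<sqsubseteq> x" "u \<in> carrier L" "z \<in> carrier L" for u z
    using that assms le_trans by blast
  then show ?thesis
    using assms by (auto simp: mem_Lower_iff mem_Upper_iff)
qed

lemma Upper_Un_principal:
  assumes "x \<in> carrier L" "y \<in> carrier L"
  shows "Upper L (Lower L {x} \<union> Lower L {y}) = Upper L {x, y}"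
proof -
  have "Upper L (Lower L {x} \<union> Lower L {y}) = Upper L (Lower L {x}) \<inter> Upper L (Lower L {y})"
    by (auto simp: Upper_def)
  also have "\<dots> = Upper L {x} \<inter> Upper L {y}"
    using assms by (simp add: Upper_principal)
  also have "\<dots> = Upper L {x, y}"
    by (auto simp: Upper_def)
  finally show ?thesis .
qed

text \<open>A member whose set of predecessors in \<open>C\<close> has least cardinality has no predecessor but itself.\<close>

lemma finite_minimal_below:
  assumes fin: "finite (carrier L)" and C: "C \<subseteq> carrier L" and p: "p \<in> C"
  obtains j where "j \<in> C" "j \<sqsubseteq> p" "\<And>x. x \<in> C \<Longrightarrow> x \<sqsubseteq> j \<Longrightarrow> x = j"
proof -
  define below where "below x = {y \<in> C. y \<sqsubseteq> x}" for x
  have "p \<in> below p"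
    using C p by (auto simp: below_def)
  from ex_has_least_nat[of "\<lambda>x. x \<in> below p" p "\<lambda>x. card (below x)", OF this]
  obtain j where j: "j \<in> below p" and least: "\<And>y. y \<in> below p \<Longrightarrow> card (below j) \<le> card (below y)"
    by blast
  have "x = j" if x: "x \<in> C" "x \<sqsubseteq> j" for x
  proof (rule ccontr)
    assume "x \<noteq> j"
    have carr: "x \<in> carrier L" "j \<in> carrier L" "p \<in> carrier L"
      using x j C p by (auto simp: below_def)
    have "\<not> j \<sqsubseteq> x"
      using \<open>x \<noteq> j\<close> x carr le_antisym by blast
    moreover have "below x \<subseteq> below j"
      using x carr C by (auto simp: below_def intro: le_trans)
    ultimately have "below x \<subset> below j"
      using j carr by (auto simp: below_def)
    moreover have "finite (below j)"
      using finite_subset[OF C fin] by (simp add: below_def)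
    ultimately have "card (below x) < card (below j)"
      by (rule psubset_card_mono[rotated])
    moreover have "x \<in> below p"
      using x j carr C le_trans by (fastforce simp: below_def)
    ultimately show False
      using least[of x] by simp
  qed
  then show ?thesis
    using that j by (auto simp: below_def)
qed

lemma finite_maximal_above:
  assumes "finite (carrier L)" and "C \<subseteq> carrier L" and "p \<in> C"
  obtains n where "n \<in> C" "p \<sqsubseteq> n" "\<And>x. x \<in> C \<Longrightarrow> n \<sqsubseteq> x \<Longrightarrow> x = n"
proof -
  interpret dual: partial_order "inv_gorder L"
    by (rule dual_order)
  show ?thesis
    using dual.finite_minimal_below[of C p] assms that by auto
qed

end

section \<open>Prime separation in finite distributive posets\<close>

context distributive_poset
begin

text \<open>
  Below \<open>p\<close>, take \<open>j\<close> minimal outside the ideal of \<open>m\<close>, so that everything strictly below \<open>j\<close> is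
  below \<open>m\<close>; then, above \<open>m\<close>, take \<open>n\<close> maximal outside the filter of \<open>j\<close>, so that everything
  strictly above \<open>n\<close> is above \<open>j\<close>.
  An element \<open>x\<close> neither above \<open>j\<close> nor below \<open>n\<close> would satisfy \<open>j \<in> L(U(x,n),j)\<close>, hence
  \<open>j \<in> LU(L(x,j),L(n,j))\<close> by distributivity; but \<open>n\<close> bounds both of these lower cones.
\<close>

lemma finite_prime_separation:
  assumes fin: "finite (carrier P)"
    and p: "p \<in> carrier P" and m: "m \<in> carrier P" and pm: "\<not> p \<sqsubseteq> m"
  obtains j n where "j \<in> carrier P" "n \<in> carrier P" "j \<sqsubseteq> p" "m \<sqsubseteq> n" "\<not> j \<sqsubseteq> n"
    and "\<And>x. x \<in> carrier P \<Longrightarrow> j \<sqsubseteq> x \<or> x \<sqsubseteq> n"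
proof -
  obtain j where j: "j \<in> carrier P" "\<not> j \<sqsubseteq> m" "j \<sqsubseteq> p"
    and jmin: "\<And>x. x \<in> carrier P \<Longrightarrow> \<not> x \<sqsubseteq> m \<Longrightarrow> x \<sqsubseteq> j \<Longrightarrow> x = j"
    by (rule finite_minimal_below[of "{x \<in> carrier P. \<not> x \<sqsubseteq> m}" p]) (use fin p pm in auto)
  obtain n where n: "n \<in> carrier P" "\<not> j \<sqsubseteq> n" "m \<sqsubseteq> n"
    and nmax: "\<And>x. x \<in> carrier P \<Longrightarrow> \<not> j \<sqsubseteq> x \<Longrightarrow> n \<sqsubseteq> x \<Longrightarrow> x = n"
    by (rule finite_maximal_above[of "{x \<in> carrier P. \<not> j \<sqsubseteq> x}" m]) (use fin m j in auto)
  have "j \<sqsubseteq> x \<or> x \<sqsubseteq> n" if x: "x \<in> carrier P" for x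
  proof (rule ccontr)
    assume neg: "\<not> (j \<sqsubseteq> x \<or> x \<sqsubseteq> n)"
    have "j \<sqsubseteq> u" if "u \<in> Upper P {x, n}" for u
      using that nmax[of u] neg x n by (auto simp: mem_Upper_iff)
    then have "j \<in> Lower P (Upper P {x, n} \<union> {j})"
      using j by (auto simp: mem_Lower_iff)
    then have j_mem: "j \<in> Lower P (Upper P (Lower P {x, j} \<union> Lower P {n, j}))"
      using Lower_Upper_distrib[of x n j] x n j by simp
    have "w \<sqsubseteq> n" if "w \<in> Lower P {x, j}" for w
    proof -
      have w: "w \<in> carrier P" "w \<sqsubseteq> x" "w \<sqsubseteq> j"
        using that x j by (auto simp: mem_Lower_iff)
      then have "w \<sqsubseteq> m"
        using jmin[of w] neg by auto
      then show ?thesis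
        using w m n le_trans by blast
    qed
    then have "n \<in> Upper P (Lower P {x, j} \<union> Lower P {n, j})"
      using n j by (auto simp: mem_Upper_iff mem_Lower_iff)
    then show False
      using j_mem n by (auto simp: mem_Lower_iff)
  qed
  then show ?thesis
    using that j n by blast
qed

text \<open>
  If \<open>p\<close> is in the left side but not in the right side, separate it from an upper bound \<open>m\<close> of
  \<open>X \<inter> Y\<close> and \<open>X \<inter> Z\<close>. No element of \<open>Y \<union> Z\<close> lies above \<open>j\<close>, since then \<open>j\<close> would be in one of
  these intersections; so \<open>n\<close> bounds \<open>Y \<union> Z\<close>, contradicting \<open>j \<in> LU(Y,Z)\<close>.
\<close>

lemma finite_cuts_distrib:
  assumes fin: "finite (carrier P)"
    and X: "X \<subseteq> carrier P" "Lower P (Upper P X) = X"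
    and Y: "Y \<subseteq> carrier P" "Lower P (Upper P Y) = Y"
    and Z: "Z \<subseteq> carrier P" "Lower P (Upper P Z) = Z"
  shows "X \<inter> Lower P (Upper P (Y \<union> Z)) \<subseteq> Lower P (Upper P ((X \<inter> Y) \<union> (X \<inter> Z)))"
proof
  have down: "x \<in> A"
    if "A \<subseteq> carrier P" "Lower P (Upper P A) = A" "y \<in> A" "x \<in> carrier P" "x \<sqsubseteq> y" for A x y
  proof -
    have "x \<in> Lower P (Upper P A)"
      using that(1,3-5) by (auto simp: mem_Lower_iff mem_Upper_iff intro: le_trans)
    with that(2) show ?thesis by simp
  qed
  fix p
  assume p: "p \<in> X \<inter> Lower P (Upper P (Y \<union> Z))"
  then have pc: "p \<in> carrier P"
    using X by blast
  have "p \<sqsubseteq> m" if m: "m \<in> Upper P ((X \<inter> Y) \<union> (X \<inter> Z))" for m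
  proof (rule ccontr)
    assume "\<not> p \<sqsubseteq> m"
    have mc: "m \<in> carrier P" and mb: "\<And>x. x \<in> X \<Longrightarrow> x \<in> Y \<union> Z \<Longrightarrow> x \<sqsubseteq> m"
      using m X by (auto simp: Upper_def)
    obtain j n where j: "j \<in> carrier P" "j \<sqsubseteq> p" and n: "n \<in> carrier P" "m \<sqsubseteq> n"
      and jn: "\<not> j \<sqsubseteq> n" and split: "\<And>x. x \<in> carrier P \<Longrightarrow> j \<sqsubseteq> x \<or> x \<sqsubseteq> n"
      using finite_prime_separation[OF fin pc mc \<open>\<not> p \<sqsubseteq> m\<close>] by metis
    have jX: "j \<in> X"
      using down[OF X] p j by blast
    have "x \<sqsubseteq> n" if x: "x \<in> Y \<union> Z" for x
    proof (rule ccontr)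
      assume "\<not> x \<sqsubseteq> n"
      then have "j \<sqsubseteq> x"
        using split[of x] x Y Z by blast
      then have "j \<in> Y \<union> Z"
        using down[OF Y] down[OF Z] x j by blast
      then have "j \<sqsubseteq> m"
        using mb jX by blast
      then show False
        using jn j n mc le_trans by blast
    qed
    then have "n \<in> Upper P (Y \<union> Z)"
      using n Y Z by (auto simp: mem_Upper_iff)
    then have "p \<sqsubseteq> n"
      using p by (auto simp: mem_Lower_iff)
    then show False
      using jn j n pc le_trans by blast
  qed
  then show "p \<in> Lower P (Upper P ((X \<inter> Y) \<union> (X \<inter> Z)))"
    using pc by (auto simp: mem_Lower_iff)
qed

end

section \<open>The lattice operations of the completion\<close>

context antitone_involution_poset
begin

lemma mem_DM_iff:
  "X \<in> carrier (DM P) \<longleftrightarrow> X \<subseteq> carrier P \<and> Lower P (Upper P X) = X"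
proof
  assume "X \<in> carrier (DM P)"
  then show "X \<subseteq> carrier P \<and> Lower P (Upper P X) = X"
    using Lower_Upper_Lower by (auto simp: DM_def)
next
  assume "X \<subseteq> carrier P \<and> Lower P (Upper P X) = X"
  then have "X = Lower P (Upper P X)"
    by simp
  then show "X \<in> carrier (DM P)"
    using Upper_closed[of P X] unfolding DM_def partial_object.simps mem_Collect_eq by metis
qed

lemma Lower_in_DM:
  assumes "A \<subseteq> carrier P"
  shows "Lower P A \<in> carrier (DM P)"
  using assms by (auto simp: DM_def)

lemma DM_le [simp]: "le (DM P) = (\<subseteq>)"
  by (simp add: DM_def)

lemma DM_invol: "invol (DM P) A = Lower P (invol P ` A)"
  by (simp add: DM_def)

lemma partial_order_DM: "partial_order (DM P)"
  by unfold_locales (auto simp: DM_def)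

lemma greatest_Int_DM:
  assumes "A \<in> carrier (DM P)" "B \<in> carrier (DM P)"
  shows "greatest (DM P) (A \<inter> B) (Lower (DM P) {A, B})"
proof (rule greatest_LowerI)
  have A: "A \<subseteq> carrier P" "Lower P (Upper P A) = A"
    and B: "B \<subseteq> carrier P" "Lower P (Upper P B) = B"
    using assms by (auto simp: mem_DM_iff)
  have "A \<inter> B = Lower P (Upper P A \<union> Upper P B)"
    using A(2) B(2) by (auto simp: Lower_def)
  then show "A \<inter> B \<in> carrier (DM P)"
    using Lower_in_DM[of "Upper P A \<union> Upper P B"] by simp
qed (use assms in \<open>auto simp: Lower_def\<close>)

lemma least_LU_DM:
  assumes "A \<in> carrier (DM P)" "B \<in> carrier (DM P)"
  shows "least (DM P) (Lower P (Upper P (A \<union> B))) (Upper (DM P) {A, B})"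
proof (rule least_UpperI)
  have AB: "A \<union> B \<subseteq> carrier P"
    using assms by (auto simp: mem_DM_iff)
  show "Lower P (Upper P (A \<union> B)) \<in> carrier (DM P)"
    by (simp add: Lower_in_DM)
  show "x \<sqsubseteq>\<^bsub>DM P\<^esub> Lower P (Upper P (A \<union> B))" if "x \<in> {A, B}" for x
    using subset_Lower_Upper[OF AB] that by auto
  show "Lower P (Upper P (A \<union> B)) \<sqsubseteq>\<^bsub>DM P\<^esub> y" if "y \<in> Upper (DM P) {A, B}" for y
  proof -
    have "A \<union> B \<subseteq> y" and y: "Lower P (Upper P y) = y"
      using that assms by (auto simp: Upper_def mem_DM_iff)
    then show ?thesis
      using Lower_antimono[OF Upper_antimono[of "A \<union> B" y P], of P] by simp
  qed
qed (use assms in auto)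

lemma lattice_DM: "lattice (DM P)"
proof -
  interpret DM: partial_order "DM P"
    by (rule partial_order_DM)
  show ?thesis
    by unfold_locales (blast intro: greatest_Int_DM least_LU_DM)+
qed

lemma DM_meet:
  assumes "A \<in> carrier (DM P)" "B \<in> carrier (DM P)"
  shows "A \<sqinter>\<^bsub>DM P\<^esub> B = A \<inter> B"
proof -
  interpret DM: lattice "DM P"
    by (rule lattice_DM)
  show ?thesis
    by (rule DM.meetI)
      (use assms greatest_Int_DM[OF assms] DM.greatest_unique in auto)
qed

lemma DM_join:
  assumes "A \<in> carrier (DM P)" "B \<in> carrier (DM P)"
  shows "A \<squnion>\<^bsub>DM P\<^esub> B = Lower P (Upper P (A \<union> B))"
proof -
  interpret DM: lattice "DM P"
    by (rule lattice_DM)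
  show ?thesis
    by (rule DM.joinI)
      (use assms least_LU_DM[OF assms] DM.least_unique in auto)
qed

lemma le_invol_iff:
  assumes "x \<in> carrier P" "y \<in> carrier P"
  shows "x \<sqsubseteq> invol P y \<longleftrightarrow> y \<sqsubseteq> invol P x"
  using assms invol_antitone[of x "invol P y"] invol_antitone[of y "invol P x"]
  by (auto simp: invol_closed invol_invol)

lemma mem_DM_invol_iff:
  assumes "A \<subseteq> carrier P"
  shows "x \<in> invol (DM P) A \<longleftrightarrow> x \<in> carrier P \<and> (\<forall>a\<in>A. x \<sqsubseteq> invol P a)"
proof -
  have "invol P ` A \<subseteq> carrier P"
    using assms by (auto intro: invol_closed)
  then show ?thesis
    by (simp add: DM_invol mem_Lower_iff)
qed

text \<open>
  An element \<open>x\<close> lies below every \<open>a'\<close> exactly when \<open>x'\<close> lies above every \<open>a\<close>, so \<open>A\<^sup>*\<close> is the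
  image of \<open>U(A)\<close> under the involution.
\<close>

lemma mem_DM_invol_iff_Upper:
  assumes "A \<subseteq> carrier P"
  shows "x \<in> invol (DM P) A \<longleftrightarrow> x \<in> carrier P \<and> invol P x \<in> Upper P A"
proof -
  have "x \<sqsubseteq> invol P a \<longleftrightarrow> a \<sqsubseteq> invol P x" if "x \<in> carrier P" "a \<in> A" for a
    using that assms le_invol_iff by blast
  then show ?thesis
    using assms by (auto simp: mem_DM_invol_iff mem_Upper_iff invol_closed)
qed

lemma DM_invol_principal:
  assumes "x \<in> carrier P"
  shows "invol (DM P) (Lower P {x}) = Lower P {invol P x}"
proof (rule Set.set_eqI)
  fix y
  show "y \<in> invol (DM P) (Lower P {x}) \<longleftrightarrow> y \<in> Lower P {invol P x}"
  proof (cases "y \<in> carrier P")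
    case True
    then show ?thesis
      using assms le_invol_iff[of x y]
      by (simp add: mem_DM_invol_iff_Upper Upper_principal mem_Upper_iff mem_Lower_iff invol_closed)
  next
    case False
    then show ?thesis
      using assms by (simp add: mem_DM_invol_iff_Upper mem_Lower_iff invol_closed)
  qed
qed

lemma antitone_involution_poset_DM: "antitone_involution_poset (DM P)"
proof -
  interpret DM: partial_order "DM P"
    by (rule partial_order_DM)
  show ?thesis
  proof unfold_locales
    show closed: "invol (DM P) A \<in> carrier (DM P)" if "A \<in> carrier (DM P)" for A
      using that by (auto simp: DM_invol mem_DM_iff intro!: Lower_Upper_Lower invol_closed)
    show "invol (DM P) B \<sqsubseteq>\<^bsub>DM P\<^esub> invol (DM P) A" if "A \<sqsubseteq>\<^bsub>DM P\<^esub> B" for A B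
      using that by (auto simp: DM_invol intro!: Lower_antimono)
    show "invol (DM P) (invol (DM P) A) = A" if A: "A \<in> carrier (DM P)" for A
    proof -
      have Ac: "A \<subseteq> carrier P" and LU: "Lower P (Upper P A) = A"
        using A by (auto simp: mem_DM_iff)
      have sub: "invol (DM P) A \<subseteq> carrier P"
        by (simp add: DM_invol)
      have "x \<in> Lower P (Upper P A)" if x: "x \<in> invol (DM P) (invol (DM P) A)" for x
      proof -
        have xc: "x \<in> carrier P" and xb: "\<And>y. y \<in> invol (DM P) A \<Longrightarrow> x \<sqsubseteq> invol P y"
          using x sub by (simp_all add: mem_DM_invol_iff)
        have "x \<sqsubseteq> u" if u: "u \<in> Upper P A" for u
        proof -
          have uc: "u \<in> carrier P"
            using u Ac by (simp add: mem_Upper_iff)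
          then have "invol P u \<in> invol (DM P) A"
            using u Ac by (simp add: mem_DM_invol_iff_Upper invol_closed invol_invol)
          from xb[OF this] show ?thesis
            using uc by (simp add: invol_invol)
        qed
        then show ?thesis
          using xc by (simp add: mem_Lower_iff)
      qed
      moreover have "x \<in> invol (DM P) (invol (DM P) A)" if x: "x \<in> A" for x
      proof -
        have "x \<sqsubseteq> invol P y" if y: "y \<in> invol (DM P) A" for y
          using x y Ac by (simp add: mem_DM_invol_iff_Upper mem_Upper_iff)
        then show ?thesis
          using x Ac sub by (simp add: mem_DM_invol_iff subset_iff)
      qed
      ultimately show ?thesis
        using LU by (metis subsetI subset_antisym)
    qed
  qed
qed

section \<open>Transfer of the two laws\<close>

lemma pseudo_kleene_algebra_DM_iff:
  "pseudo_kleene_algebra (DM P) \<longleftrightarrow> pseudo_kleene_poset P"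
proof
  assume "pseudo_kleene_algebra (DM P)"
  then interpret DM: pseudo_kleene_algebra "DM P" .
  show "pseudo_kleene_poset P"
  proof unfold_locales
    fix x y
    assume xy: "x \<in> carrier P" "y \<in> carrier P"
    have principal: "Lower P {a} \<in> carrier (DM P)" if "a \<in> carrier P" for a
      using that by (simp add: Lower_in_DM)
    have "Lower P {x, invol P x} = Lower P {x} \<inter> Lower P {invol P x}"
      by (auto simp: Lower_def)
    also have "\<dots> = Lower P {x} \<sqinter>\<^bsub>DM P\<^esub> invol (DM P) (Lower P {x})"
      using xy by (simp add: DM_invol_principal DM_meet principal invol_closed)
    also have "\<dots> \<subseteq> Lower P {y} \<squnion>\<^bsub>DM P\<^esub> invol (DM P) (Lower P {y})"
      using DM.meet_le_join[of "Lower P {x}" "Lower P {y}"] xy principal by simp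
    also have "\<dots> = Lower P (Upper P {y, invol P y})"
      using xy by (simp add: DM_invol_principal DM_join principal invol_closed Upper_Un_principal)
    finally show "set_le P (Lower P {x, invol P x}) (Upper P {y, invol P y})"
      by (auto simp: set_le_def mem_Lower_iff subset_iff)
  qed
next
  assume "pseudo_kleene_poset P"
  then interpret pseudo_kleene_poset P .
  interpret DM: lattice "DM P"
    by (rule lattice_DM)
  interpret DM: antitone_involution_poset "DM P"
    by (rule antitone_involution_poset_DM)
  show "pseudo_kleene_algebra (DM P)"
  proof unfold_locales
    fix A B
    assume A: "A \<in> carrier (DM P)" and B: "B \<in> carrier (DM P)"
    have sub: "A \<subseteq> carrier P" "B \<subseteq> carrier P" "invol (DM P) B \<subseteq> carrier P"
      using A B by (auto simp: mem_DM_iff DM_invol)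
    have "x \<sqsubseteq> u" if x: "x \<in> A" "x \<in> invol (DM P) A"
      and u: "u \<in> Upper P (B \<union> invol (DM P) B)" for x u
    proof -
      have carr: "x \<in> carrier P" "u \<in> carrier P"
        using x u sub by (auto simp: Upper_def)
      have "x \<sqsubseteq> invol P x"
        using x sub by (simp add: mem_DM_invol_iff)
      then have xm: "x \<in> Lower P {x, invol P x}"
        using carr by (simp add: mem_Lower_iff invol_closed)
      \<comment> \<open>As \<open>u\<close> bounds \<open>B\<close>, its image lies in \<open>B\<^sup>*\<close>, which \<open>u\<close> bounds as well.\<close>
      have "u \<in> Upper P B"
        using u Upper_antimono[of B "B \<union> invol (DM P) B" P] by auto
      then have "invol P u \<in> invol (DM P) B"
        using sub carr by (simp add: mem_DM_invol_iff_Upper invol_closed invol_invol)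
      then have "invol P u \<sqsubseteq> u"
        using u sub by (simp add: mem_Upper_iff)
      then have "u \<in> Upper P {u, invol P u}"
        using carr by (simp add: mem_Upper_iff invol_closed)
      then show ?thesis
        using Lower_le_Upper[of x u] xm carr by (auto simp: set_le_def)
    qed
    then have "A \<inter> invol (DM P) A \<subseteq> Lower P (Upper P (B \<union> invol (DM P) B))"
      using sub by (auto simp: mem_Lower_iff)
    then show "A \<sqinter>\<^bsub>DM P\<^esub> invol (DM P) A \<sqsubseteq>\<^bsub>DM P\<^esub> B \<squnion>\<^bsub>DM P\<^esub> invol (DM P) B"
      using A B by (simp add: DM_meet DM_join DM.invol_closed)
  qed
qed

text \<open>
  The ideal \<open>LU(x,y)\<close> is the join of the principal ideals of \<open>x\<close> and \<open>y\<close>, and \<open>L(x,z)\<close> is the meet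
  of those of \<open>x\<close> and \<open>z\<close>, so the law for elements is the lattice law at principal ideals.
\<close>

lemma distributive_poset_if_DM:
  assumes "distributive_lattice (DM P)"
  shows "distributive_poset P"
proof -
  interpret DM: distributive_lattice "DM P"
    by (rule assms)
  show ?thesis
  proof unfold_locales
    fix x y z
    assume xyz: "x \<in> carrier P" "y \<in> carrier P" "z \<in> carrier P"
    define X Y Z where "X = Lower P {x}" and "Y = Lower P {y}" and "Z = Lower P {z}"
    have XYZ: "X \<in> carrier (DM P)" "Y \<in> carrier (DM P)" "Z \<in> carrier (DM P)"
      using xyz by (simp_all add: X_def Y_def Z_def Lower_in_DM)
    have "Lower P (Upper P {x, y} \<union> {z}) = Z \<inter> Lower P (Upper P {x, y})"
      by (auto simp: Z_def Lower_def)
    also have "\<dots> = Z \<inter> Lower P (Upper P (X \<union> Y))"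
      using xyz by (simp add: X_def Y_def Upper_Un_principal)
    also have "\<dots> = Z \<sqinter>\<^bsub>DM P\<^esub> (X \<squnion>\<^bsub>DM P\<^esub> Y)"
      using XYZ DM.join_closed[of X Y] by (simp add: DM_join DM_meet)
    also have "\<dots> = (Z \<sqinter>\<^bsub>DM P\<^esub> X) \<squnion>\<^bsub>DM P\<^esub> (Z \<sqinter>\<^bsub>DM P\<^esub> Y)"
      using XYZ by (intro DM.meet_join_distrib)
    also have "\<dots> = Lower P (Upper P ((Z \<inter> X) \<union> (Z \<inter> Y)))"
      using XYZ DM.meet_closed[of Z X] DM.meet_closed[of Z Y] by (simp add: DM_join DM_meet)
    also have "Z \<inter> X = Lower P {x, z}"
      by (auto simp: Z_def X_def Lower_def)
    also have "Z \<inter> Y = Lower P {y, z}"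
      by (auto simp: Z_def Y_def Lower_def)
    finally show "Lower P (Upper P {x, y} \<union> {z}) =
        Lower P (Upper P (Lower P {x, z} \<union> Lower P {y, z}))" .
  qed
qed

lemma distributive_lattice_DM_if_finite:
  assumes "distributive_poset P" and fin: "finite (carrier P)"
  shows "distributive_lattice (DM P)"
proof -
  interpret dist: distributive_poset P
    by (rule assms)
  interpret DM: lattice "DM P"
    by (rule lattice_DM)
  show ?thesis
  proof unfold_locales
    fix X Y Z
    assume XYZ: "X \<in> carrier (DM P)" "Y \<in> carrier (DM P)" "Z \<in> carrier (DM P)"
    have "X \<sqinter>\<^bsub>DM P\<^esub> (Y \<squnion>\<^bsub>DM P\<^esub> Z) \<subseteq> (X \<sqinter>\<^bsub>DM P\<^esub> Y) \<squnion>\<^bsub>DM P\<^esub> (X \<sqinter>\<^bsub>DM P\<^esub> Z)"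
      using dist.finite_cuts_distrib[OF fin, of X Y Z] XYZ
        DM.join_closed[of Y Z] DM.meet_closed[of X Y] DM.meet_closed[of X Z]
      by (simp add: DM_join DM_meet mem_DM_iff)
    moreover have "(X \<sqinter>\<^bsub>DM P\<^esub> Y) \<squnion>\<^bsub>DM P\<^esub> (X \<sqinter>\<^bsub>DM P\<^esub> Z) \<subseteq> X \<sqinter>\<^bsub>DM P\<^esub> (Y \<squnion>\<^bsub>DM P\<^esub> Z)"
    proof -
      have "Lower P (Upper P ((X \<inter> Y) \<union> (X \<inter> Z))) \<subseteq> Lower P (Upper P X)"
        "Lower P (Upper P ((X \<inter> Y) \<union> (X \<inter> Z))) \<subseteq> Lower P (Upper P (Y \<union> Z))"
        by (rule Lower_antimono, rule Upper_antimono, blast)+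
      then show ?thesis
        using XYZ DM.join_closed[of Y Z] DM.meet_closed[of X Y] DM.meet_closed[of X Z]
        by (simp add: DM_join DM_meet mem_DM_iff)
    qed
    ultimately show "X \<sqinter>\<^bsub>DM P\<^esub> (Y \<squnion>\<^bsub>DM P\<^esub> Z) = (X \<sqinter>\<^bsub>DM P\<^esub> Y) \<squnion>\<^bsub>DM P\<^esub> (X \<sqinter>\<^bsub>DM P\<^esub> Z)"
      by blast
  qed
qed

end

theorem theorem3p2:
  fixes P :: "'a igorder"
  assumes "antitone_involution_poset P"
    and "finite (carrier P)"
  shows "kleene_algebra (DM P) \<longleftrightarrow> kleene_poset P"
proof -
  interpret antitone_involution_poset P
    by (rule assms)
  have "kleene_algebra (DM P) \<longleftrightarrow> pseudo_kleene_algebra (DM P) \<and> distributive_lattice (DM P)"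
    by (auto simp: kleene_algebra_def distributive_lattice_def)
  also have "\<dots> \<longleftrightarrow> pseudo_kleene_poset P \<and> distributive_poset P"
    using pseudo_kleene_algebra_DM_iff distributive_poset_if_DM
      distributive_lattice_DM_if_finite[OF _ assms(2)] by blast
  also have "\<dots> \<longleftrightarrow> kleene_poset P"
    by (auto simp: kleene_poset_def distributive_poset_def)
  finally show ?thesis .
qed

end
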